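(* Let $f:\mathbb{U}\rightarrow\mathbb{U}$ be a (complex-valued) harmonic function such that (C1) $f(0)=0$, and (C2) $\|df(0)\|=d$, where $d\leqslant\frac{4}{\pi}$. Put $C=\frac{\pi}{4}d$. Then, for all $z\in\mathbb{U}$, $$|f(z)|\leqslant\frac{4}{\pi}\arctan\big(|z|\varphi_{C}(|z|)\big).$$
   Context: $\mathbb{U}=\{z\in\mathbb{C}:|z|<1\}$ is the open unit disk. A complex-valued function $f=u+iv$ is harmonic if its real part $u$ and imaginary part $v$ are harmonic. $df(z)$ denotes the differential of $f$ at $z$, i.e. the real Jacobian matrix $\begin{pmatrix}u_x(z)&u_y(z)\\ v_x(z)&v_y(z)\end{pmatrix}$ viewed as an $\mathbb{R}$-linear operator on $\mathbb{R}^2$, and $\|df(z)\|$ is its operator norm with respect to the Euclidean norm; equivalently $\|df(z)\|=|f_z(z)|+|f_{\overline{z}}(z)|$ with $f_z=\frac12(f_x-if_y)$, $f_{\overline z}=\frac12(f_x+if_y)$. For real $C\in[0,1)$ and $t\in[0,1)$, $\varphi_C(t)=\frac{C+t}{1+Ct}$. Convention: if $C=1$, then $\varphi_C(|z|)$ is understood to be $1$ for all $z\in\mathbb{U}$. *)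

theory Defs
  imports "HOL-Analysis.Analysis"
begin

definition partial_x :: "(complex \<Rightarrow> real) \<Rightarrow> complex \<Rightarrow> real" where
  "partial_x u z = frechet_derivative u (at z) 1"

definition partial_y :: "(complex \<Rightarrow> real) \<Rightarrow> complex \<Rightarrow> real" where
  "partial_y u z = frechet_derivative u (at z) \<i>"

definition C1_on :: "complex set \<Rightarrow> (complex \<Rightarrow> real) \<Rightarrow> bool" where
  "C1_on S u \<longleftrightarrow> (\<forall>z\<in>S. u differentiable (at z)) \<and>
     continuous_on S (partial_x u) \<and> continuous_on S (partial_y u)"

definition C2_on :: "complex set \<Rightarrow> (complex \<Rightarrow> real) \<Rightarrow> bool" where
  "C2_on S u \<longleftrightarrow> C1_on S u \<and> C1_on S (partial_x u) \<and> C1_on S (partial_y u)"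

text \<open>Intended for open \<open>S\<close>: derivatives are taken at full neighbourhoods of points of \<open>S\<close>.\<close>

definition real_harmonic_on :: "complex set \<Rightarrow> (complex \<Rightarrow> real) \<Rightarrow> bool" where
  "real_harmonic_on S u \<longleftrightarrow> C2_on S u \<and>
     (\<forall>z\<in>S. partial_x (partial_x u) z + partial_y (partial_y u) z = 0)"

definition harmonic_on :: "complex set \<Rightarrow> (complex \<Rightarrow> complex) \<Rightarrow> bool" where
  "harmonic_on S f \<longleftrightarrow>
     real_harmonic_on S (\<lambda>z. Re (f z)) \<and> real_harmonic_on S (\<lambda>z. Im (f z))"

text \<open>The Frechet derivative on \<open>complex\<close> is the \<open>\<real>\<close>-linear map given by the real Jacobian
  matrix, and \<open>onorm\<close> is its operator norm for the Euclidean norm.\<close>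

definition diff_norm :: "(complex \<Rightarrow> complex) \<Rightarrow> complex \<Rightarrow> real" where
  "diff_norm f z = onorm (frechet_derivative f (at z))"

definition phi :: "real \<Rightarrow> real \<Rightarrow> real" where
  "phi C t = (if C = 1 then 1 else (C + t) / (1 + C * t))"

end

theory Submission
  imports Defs "HOL-Complex_Analysis.Complex_Analysis"
begin

text \<open>
  Choose a unimodular \<open>e\<close> with \<open>e * f z = \<bar>f z\<bar>\<close>. On the disk \<open>Re (e * f)\<close> is the real part of a
  holomorphic \<open>F\<close> with \<open>F 0 = 0\<close>, whose values lie in the strip \<open>\<bar>Re w\<bar> < 1\<close> and for which
  \<open>\<bar>F' 0\<bar>\<close> is at most the norm of the differential of \<open>f\<close> at \<open>0\<close>. The map \<open>w \<mapsto> tan (\<pi> w / 4)\<close> carries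
  the strip into the unit disk, so the Schwarz lemma, refined by the value of the derivative at \<open>0\<close>,
  bounds \<open>h = tan (\<pi> F / 4)\<close>; the estimate \<open>tan \<bar>Re w\<bar> \<le> \<bar>tan w\<bar>\<close> on \<open>\<bar>Re w\<bar> < \<pi> / 4\<close> transfers
  this bound back to \<open>Re F\<close>.
\<close>

section \<open>Symmetry of mixed second derivatives\<close>

text \<open>The mean value theorem along \<open>a\<close> turns the second difference into
  \<open>t\<close> times the change of \<open>U _ a\<close> caused by a shift of \<open>t\<close>
  along \<open>b\<close>. Differentiability of \<open>U _ a\<close> at \<open>p\<close> makes that
  change \<open>t * L b\<close> up to an error of order o(t).\<close>

lemma second_difference_tendsto:
  fixes u :: "'a::real_normed_vector \<Rightarrow> real"
  assumes "r > 0"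
    and U: "\<And>z. z \<in> ball p r \<Longrightarrow> (u has_derivative U z) (at z)"
    and L: "((\<lambda>z. U z a) has_derivative L) (at p)"
  shows "((\<lambda>t. (u (p + t *\<^sub>R a + t *\<^sub>R b) - u (p + t *\<^sub>R a) - u (p + t *\<^sub>R b) + u p) / t\<^sup>2)
           \<longlongrightarrow> L b) (at_right 0)"
proof (rule tendstoI)
  fix e :: real assume "e > 0"
  \<comment> \<open>\<open>K\<close> is chosen so that every point
    \<open>p + s *\<^sub>R a + c *\<^sub>R b\<close> with \<open>s\<close>, \<open>c\<close> in
    [0, t] lies within \<open>t * K\<close> of \<open>p\<close>; the summand 1 keeps it positive
    when both directions vanish.\<close>
  define K where "K = norm a + norm b + 1"
  have "K \<ge> 1" by (simp add: K_def)
  have lin: "bounded_linear L" using L by (rule has_derivative_bounded_linear)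
  \<comment> \<open>With this tolerance each of the two linearization errors below is at most
    \<open>e / 4 * t\<close>, which leaves \<open>e / 2\<close> after division by
    \<open>t\<close>.\<close>
  have "e / (4 * K) > 0" using \<open>e > 0\<close> \<open>K \<ge> 1\<close> by simp
  then obtain \<delta> where "\<delta> > 0" and \<delta>: "\<And>y. norm (y - p) < \<delta> \<Longrightarrow>
      norm (U y a - U p a - L (y - p)) \<le> e / (4 * K) * norm (y - p)"
    using L unfolding has_derivative_at_alt by blast
  define m where "m = min \<delta> r / K"
  have "m > 0" using \<open>\<delta> > 0\<close> \<open>r > 0\<close> \<open>K \<ge> 1\<close> by (simp add: m_def)
  have "dist ((u (p + t *\<^sub>R a + t *\<^sub>R b) - u (p + t *\<^sub>R a) - u (p + t *\<^sub>R b) + u p) / t\<^sup>2) (L b) < e"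
    if "0 < t" "t < m" for t
  proof -
    have tK: "t * K < min \<delta> r"
      using that \<open>K \<ge> 1\<close> by (simp add: m_def field_simps)
    have near: "norm (s *\<^sub>R a + c *\<^sub>R b) \<le> t * K" if "0 \<le> s" "s \<le> t" "0 \<le> c" "c \<le> t" for s c
    proof -
      have "norm (s *\<^sub>R a + c *\<^sub>R b) \<le> s * norm a + c * norm b"
        using norm_triangle_ineq[of "s *\<^sub>R a" "c *\<^sub>R b"] that by simp
      also have "\<dots> \<le> t * norm a + t * norm b"
        using that by (intro add_mono mult_right_mono) auto
      also have "\<dots> \<le> t * K" using \<open>0 < t\<close> by (simp add: K_def algebra_simps)
      finally show ?thesis .
    qed
    have inb: "p + s *\<^sub>R a + c *\<^sub>R b \<in> ball p r" if "0 \<le> s" "s \<le> t" "0 \<le> c" "c \<le> t" for s c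
      using near[OF that] tK norm_minus_cancel[of "s *\<^sub>R a + c *\<^sub>R b"] by (simp add: dist_norm algebra_simps)
    have D: "((\<lambda>s. u (p + s *\<^sub>R a + c *\<^sub>R b)) has_real_derivative U (p + s *\<^sub>R a + c *\<^sub>R b) a) (at s)"
      if "0 \<le> s" "s \<le> t" "0 \<le> c" "c \<le> t" for s c
    proof -
      have Us: "(u has_derivative U (p + s *\<^sub>R a + c *\<^sub>R b)) (at (p + s *\<^sub>R a + c *\<^sub>R b))"
        using U inb that by blast
      have "((\<lambda>s. p + s *\<^sub>R a + c *\<^sub>R b) has_derivative (\<lambda>h. h *\<^sub>R a)) (at s)"
        by (auto intro!: derivative_eq_intros)
      from has_derivative_compose[OF this Us]
      have "((\<lambda>s. u (p + s *\<^sub>R a + c *\<^sub>R b)) has_derivative (\<lambda>h. U (p + s *\<^sub>R a + c *\<^sub>R b) (h *\<^sub>R a))) (at s)" .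
      moreover have "linear (U (p + s *\<^sub>R a + c *\<^sub>R b))"
        using Us has_derivative_linear by blast
      ultimately show ?thesis
        by (simp add: has_field_derivative_def linear_cmul mult.commute[of "U _ _"] mult_commute_abs)
    qed
    \<comment> \<open>\<open>\<phi> t - \<phi> 0\<close> is the whole second difference.\<close>
    define \<phi> where "\<phi> = (\<lambda>s. u (p + s *\<^sub>R a + t *\<^sub>R b) - u (p + s *\<^sub>R a))"
    have D\<phi>: "(\<phi> has_real_derivative (U (p + s *\<^sub>R a + t *\<^sub>R b) a - U (p + s *\<^sub>R a) a)) (at s)"
      if "0 \<le> s" "s \<le> t" for s
      unfolding \<phi>_def using D[of s t] D[of s 0] that by (auto intro!: DERIV_diff)
    obtain s where s: "0 < s" "s < t"
      and \<phi>s: "\<phi> t - \<phi> 0 = (t - 0) * (U (p + s *\<^sub>R a + t *\<^sub>R b) a - U (p + s *\<^sub>R a) a)"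
      using MVT2[OF \<open>0 < t\<close> D\<phi>] by blast
    have bound: "\<bar>U (p + s *\<^sub>R a + c *\<^sub>R b) a - U p a - L (s *\<^sub>R a + c *\<^sub>R b)\<bar> \<le> e / 4 * t"
      if "0 \<le> c" "c \<le> t" for c
    proof -
      have n: "norm (s *\<^sub>R a + c *\<^sub>R b) \<le> t * K" using near s that by simp
      have eq: "p + s *\<^sub>R a + c *\<^sub>R b - p = s *\<^sub>R a + c *\<^sub>R b" by simp
      have "\<bar>U (p + s *\<^sub>R a + c *\<^sub>R b) a - U p a - L (s *\<^sub>R a + c *\<^sub>R b)\<bar>
            \<le> e / (4 * K) * norm (s *\<^sub>R a + c *\<^sub>R b)"
        using \<delta>[of "p + s *\<^sub>R a + c *\<^sub>R b"] n tK unfolding eq by simp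
      also have "\<dots> \<le> e / (4 * K) * (t * K)"
        using n \<open>e > 0\<close> \<open>K \<ge> 1\<close> by (intro mult_left_mono) auto
      also have "\<dots> = e / 4 * t" using \<open>K \<ge> 1\<close> by simp
      finally show ?thesis .
    qed
    have Lsum: "L (s *\<^sub>R a + t *\<^sub>R b) = L (s *\<^sub>R a) + t * L b"
      using lin by (simp add: bounded_linear.linear linear_add linear_cmul)
    \<comment> \<open>The linearization at \<open>p\<close> is used at two points,
      \<open>c = t\<close> and \<open>c = 0\<close>. Subtracting cancels \<open>U p a\<close> and
      \<open>L (s *\<^sub>R a)\<close>, so that only \<open>t * L b\<close> remains.\<close>
    have "\<bar>(U (p + s *\<^sub>R a + t *\<^sub>R b) a - U p a - L (s *\<^sub>R a + t *\<^sub>R b))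
        - (U (p + s *\<^sub>R a + 0 *\<^sub>R b) a - U p a - L (s *\<^sub>R a + 0 *\<^sub>R b))\<bar> \<le> e / 4 * t + e / 4 * t"
      using \<open>0 < t\<close> by (intro order_trans[OF abs_triangle_ineq4] add_mono bound) auto
    moreover have "(U (p + s *\<^sub>R a + t *\<^sub>R b) a - U p a - L (s *\<^sub>R a + t *\<^sub>R b))
        - (U (p + s *\<^sub>R a + 0 *\<^sub>R b) a - U p a - L (s *\<^sub>R a + 0 *\<^sub>R b))
        = (U (p + s *\<^sub>R a + t *\<^sub>R b) a - U (p + s *\<^sub>R a) a) - t * L b"
      by (simp add: Lsum)
    moreover have "e / 4 * t + e / 4 * t = e / 2 * t" by simp
    ultimately have "\<bar>(U (p + s *\<^sub>R a + t *\<^sub>R b) a - U (p + s *\<^sub>R a) a) - t * L b\<bar> \<le> e / 2 * t"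
      by (simp only:)
    moreover have "(\<phi> t - \<phi> 0) / t\<^sup>2 - L b
        = ((U (p + s *\<^sub>R a + t *\<^sub>R b) a - U (p + s *\<^sub>R a) a) - t * L b) / t"
      using \<open>0 < t\<close> unfolding \<phi>s by (simp add: field_simps power2_eq_square)
    ultimately have "\<bar>(\<phi> t - \<phi> 0) / t\<^sup>2 - L b\<bar> \<le> e / 2"
      using \<open>0 < t\<close> by (simp add: abs_divide divide_le_eq)
    then show ?thesis
      using \<open>e > 0\<close> by (simp add: \<phi>_def dist_real_def algebra_simps)
  qed
  then show "\<forall>\<^sub>F t in at_right 0.
      dist ((u (p + t *\<^sub>R a + t *\<^sub>R b) - u (p + t *\<^sub>R a) - u (p + t *\<^sub>R b) + u p) / t\<^sup>2) (L b) < e"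
    unfolding eventually_at_right_field using \<open>m > 0\<close> by blast
qed

text \<open>The second difference is symmetric in \<open>a\<close> and \<open>b\<close>, so both
  second derivatives are limits of the same quotient.\<close>

lemma mixed_derivatives_commute:
  fixes u :: "'a::real_normed_vector \<Rightarrow> real"
  assumes "r > 0"
    and "\<And>z. z \<in> ball p r \<Longrightarrow> (u has_derivative U z) (at z)"
    and "((\<lambda>z. U z a) has_derivative L) (at p)"
    and "((\<lambda>z. U z b) has_derivative M) (at p)"
  shows "L b = M a"
proof -
  have "((\<lambda>t. (u (p + t *\<^sub>R a + t *\<^sub>R b) - u (p + t *\<^sub>R a) - u (p + t *\<^sub>R b) + u p) / t\<^sup>2)
           \<longlongrightarrow> L b) (at_right 0)"
    using assms by (intro second_difference_tendsto)
  moreover have "((\<lambda>t. (u (p + t *\<^sub>R b + t *\<^sub>R a) - u (p + t *\<^sub>R b) - u (p + t *\<^sub>R a) + u p) / t\<^sup>2)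
           \<longlongrightarrow> M a) (at_right 0)"
    using assms by (intro second_difference_tendsto)
  ultimately show ?thesis
    by (intro tendsto_unique[OF trivial_limit_at_right_real[of 0]]) (simp_all add: algebra_simps)
qed

section \<open>Harmonic functions as real parts of holomorphic functions\<close>

lemma C1_on_has_derivative:
  assumes "C1_on S u" "z \<in> S"
  shows "(u has_derivative (\<lambda>h. Re h * partial_x u z + Im h * partial_y u z)) (at z)"
proof -
  let ?D = "frechet_derivative u (at z)"
  have D: "(u has_derivative ?D) (at z)"
    using assms by (auto simp: C1_on_def frechet_derivative_works)
  then have lin: "linear ?D" by (rule has_derivative_linear)
  have "?D h = Re h * partial_x u z + Im h * partial_y u z" for h
  proof -
    have "h = Re h *\<^sub>R 1 + Im h *\<^sub>R \<i>" by (simp add: complex_eq_iff)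
    then have "?D h = ?D (Re h *\<^sub>R 1 + Im h *\<^sub>R \<i>)" by simp
    also have "\<dots> = Re h * partial_x u z + Im h * partial_y u z"
      unfolding partial_x_def partial_y_def
      by (simp only: linear_add[OF lin] linear_cmul[OF lin] real_scaleR_def)
    finally show ?thesis .
  qed
  then have "?D = (\<lambda>h. Re h * partial_x u z + Im h * partial_y u z)" by blast
  with D show ?thesis by simp
qed

text \<open>The function u_x - i u_y satisfies the Cauchy-Riemann equations: one is the Laplace
  equation, the other the symmetry of mixed derivatives. By convexity it has a primitive, whose real
  part has the same differential as \<open>u\<close> and thus differs from \<open>u\<close> by a
  constant.\<close>

lemma real_harmonic_on_has_conjugate:
  assumes S: "open S" "convex S" and u: "real_harmonic_on S u"
  obtains F where "F holomorphic_on S" "\<And>z. z \<in> S \<Longrightarrow> Re (F z) = u z"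
proof -
  have C1: "C1_on S u" "C1_on S (partial_x u)" "C1_on S (partial_y u)"
    and laplace: "\<And>z. z \<in> S \<Longrightarrow> partial_x (partial_x u) z + partial_y (partial_y u) z = 0"
    using u by (auto simp: real_harmonic_on_def C2_on_def)
  note Du = C1_on_has_derivative[OF C1(1)]
    and Dx = C1_on_has_derivative[OF C1(2)]
    and Dy = C1_on_has_derivative[OF C1(3)]
  \<comment> \<open>If \<open>u\<close> is the real part of a holomorphic function, then the
    derivative of that function must be \<open>g\<close>.\<close>
  define g where "g z = Complex (partial_x u z) (- partial_y u z)" for z
  have "g field_differentiable (at z)" if z: "z \<in> S" for z
  proof -
    obtain r where "r > 0" and r: "ball z r \<subseteq> S"
      using S z openE by blast
    define U where "U w = (\<lambda>h. Re h * partial_x u w + Im h * partial_y u w)" for w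
    have U: "(u has_derivative U w) (at w)" if "w \<in> ball z r" for w
      unfolding U_def using r that by (intro Du) auto
    have "U w 1 = partial_x u w" "U w \<i> = partial_y u w" for w
      by (simp_all add: U_def)
    then have Ux: "(\<lambda>w. U w 1) = partial_x u" and Uy: "(\<lambda>w. U w \<i>) = partial_y u"
      by auto
    have sym: "partial_y (partial_x u) z = partial_x (partial_y u) z"
      using mixed_derivatives_commute[where U = U and a = 1 and b = \<i>, unfolded Ux Uy,
          OF \<open>r > 0\<close> U Dx[OF z] Dy[OF z]]
      by simp
    have "((\<lambda>w. of_real (partial_x u w) - \<i> * of_real (partial_y u w)) has_derivative
        (\<lambda>h. of_real (Re h * partial_x (partial_x u) z + Im h * partial_y (partial_x u) z)
           - \<i> * of_real (Re h * partial_x (partial_y u) z + Im h * partial_y (partial_y u) z))) (at z)"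
      by (intro derivative_intros Dx[OF z] Dy[OF z])
    moreover have "(\<lambda>w. of_real (partial_x u w) - \<i> * of_real (partial_y u w)) = g"
      by (auto simp: g_def complex_eq_iff)
    \<comment> \<open>The real differential of \<open>g\<close> is multiplication by a complex
      number; this is where harmonicity enters.\<close>
    moreover have "(\<lambda>h. of_real (Re h * partial_x (partial_x u) z + Im h * partial_y (partial_x u) z)
           - \<i> * of_real (Re h * partial_x (partial_y u) z + Im h * partial_y (partial_y u) z))
        = (*) (Complex (partial_x (partial_x u) z) (- partial_x (partial_y u) z))"
    proof -
      have "partial_y (partial_y u) z = - partial_x (partial_x u) z"
        using laplace[OF z] by simp
      then show ?thesis by (intro ext complex_eqI) (simp_all add: sym)
    qed
    ultimately have "(g has_field_derivative
        Complex (partial_x (partial_x u) z) (- partial_x (partial_y u) z)) (at z)"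
      by (simp only: has_field_derivative_def)
    then show ?thesis
      unfolding field_differentiable_def by blast
  qed
  then have "g holomorphic_on S"
    using S by (simp add: holomorphic_on_open field_differentiable_def)
  then obtain G where "\<And>z. z \<in> S \<Longrightarrow> (G has_field_derivative g z) (at z within S)"
    using holomorphic_convex_primitive'[OF S(2,1)] by blast
  then have G: "\<And>z. z \<in> S \<Longrightarrow> (G has_field_derivative g z) (at z)"
    using S by (simp add: at_within_open[of _ S])
  have "((\<lambda>z. u z - Re (G z)) has_derivative (\<lambda>h. 0)) (at z within S)" if z: "z \<in> S" for z
  proof -
    have "((\<lambda>z. u z - Re (G z)) has_derivative
        (\<lambda>h. (Re h * partial_x u z + Im h * partial_y u z) - Re (g z * h))) (at z)"
      using Du[OF z] G[OF z] unfolding has_field_derivative_def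
      by (intro derivative_intros)
    moreover have "(\<lambda>h. (Re h * partial_x u z + Im h * partial_y u z) - Re (g z * h)) = (\<lambda>h. 0)"
      by (auto simp: g_def)
    ultimately show ?thesis by (simp add: has_derivative_at_withinI)
  qed
  then have "\<exists>c. \<forall>z\<in>S. u z - Re (G z) = c"
    by (rule has_derivative_zero_constant[OF S(2)])
  then obtain c where c: "\<And>z. z \<in> S \<Longrightarrow> u z - Re (G z) = c"
    by blast
  show ?thesis
  proof
    have "G holomorphic_on S"
      using G S by (auto simp: holomorphic_on_open)
    then show "(\<lambda>z. G z + of_real c) holomorphic_on S"
      by (intro holomorphic_intros)
    show "Re (G z + of_real c) = u z" if "z \<in> S" for z
      using c[OF that] by simp
  qed
qed

section \<open>The tangent on a vertical strip\<close>

lemma norm_sin_cos_squared: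
  fixes w :: complex
  shows "(cmod (sin w))\<^sup>2 = (sin (Re w))\<^sup>2 + (sinh (Im w))\<^sup>2"
    and "(cmod (cos w))\<^sup>2 = (cos (Re w))\<^sup>2 + (sinh (Im w))\<^sup>2"
proof -
  have *: "Re (sin w) = sin (Re w) * cosh (Im w)" "Im (sin w) = cos (Re w) * sinh (Im w)"
    "Re (cos w) = cos (Re w) * cosh (Im w)" "Im (cos w) = - (sin (Re w) * sinh (Im w))"
    by (simp_all add: Re_sin Im_sin Re_cos Im_cos cosh_field_def sinh_field_def field_simps)
  have s: "(sin (Re w))\<^sup>2 = 1 - (cos (Re w))\<^sup>2" using sin_squared_eq by blast
  have ch: "(cosh (Im w))\<^sup>2 = (sinh (Im w))\<^sup>2 + 1" by (rule cosh_square_eq)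
  show "(cmod (sin w))\<^sup>2 = (sin (Re w))\<^sup>2 + (sinh (Im w))\<^sup>2"
    "(cmod (cos w))\<^sup>2 = (cos (Re w))\<^sup>2 + (sinh (Im w))\<^sup>2"
    unfolding cmod_power2 * power_mult_distrib power2_minus s ch by (simp_all add: algebra_simps)
qed

text \<open>With \<open>x = \<bar>Re w\<bar>\<close>, the square of \<open>cmod (tan w)\<close>
  arises from that of \<open>tan x\<close> by adding the same \<open>s \<ge> 0\<close> to the
  numerator and the denominator. As \<open>tan x < 1\<close>, this can only increase the fraction
  and keeps it below 1.\<close>

lemma
  fixes w :: complex
  assumes w: "\<bar>Re w\<bar> < pi / 4"
  shows cos_strip_nonzero: "cos w \<noteq> 0"
    and norm_tan_strip_less_1: "cmod (tan w) < 1"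
    and tan_Re_le_norm_tan: "tan \<bar>Re w\<bar> \<le> cmod (tan w)"
proof -
  define x where "x = \<bar>Re w\<bar>"
  define s where "s = (sinh (Im w))\<^sup>2"
  have x: "0 \<le> x" "x < pi / 4" using w by (auto simp: x_def)
  have "tan x < tan (pi / 4)" using x by (intro tan_monotone) auto
  then have "tan x < 1" by (simp add: tan_45)
  have "cos x > 0" using x by (intro cos_gt_zero_pi) auto
  have "sin x \<ge> 0" using x by (intro sin_ge_zero) auto
  have "sin x < cos x" using \<open>tan x < 1\<close> \<open>cos x > 0\<close> by (simp add: tan_def)
  then have lt: "(sin x)\<^sup>2 < (cos x)\<^sup>2"
    using \<open>sin x \<ge> 0\<close> by (intro power_strict_mono) auto
  have "s \<ge> 0" by (simp add: s_def)
  have S: "(cmod (sin w))\<^sup>2 = (sin x)\<^sup>2 + s" and C: "(cmod (cos w))\<^sup>2 = (cos x)\<^sup>2 + s"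
    unfolding norm_sin_cos_squared s_def x_def by (auto simp: abs_if)
  have "(cmod (cos w))\<^sup>2 > 0" using C \<open>cos x > 0\<close> \<open>s \<ge> 0\<close> by (simp add: add_pos_nonneg)
  then show nz: "cos w \<noteq> 0" by auto
  have "(cmod (sin w))\<^sup>2 < (cmod (cos w))\<^sup>2" using S C lt by simp
  then have "cmod (sin w) < cmod (cos w)" using power_less_imp_less_base norm_ge_zero by blast
  then show "cmod (tan w) < 1" using nz by (simp add: tan_def norm_divide)
  have "(sin x * cmod (cos w))\<^sup>2 \<le> (cos x * cmod (sin w))\<^sup>2"
    using mult_right_mono[OF less_imp_le[OF lt] \<open>s \<ge> 0\<close>]
    unfolding power_mult_distrib S C by (simp add: algebra_simps)
  then have "sin x * cmod (cos w) \<le> cos x * cmod (sin w)"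
    by (rule power2_le_imp_le) (use \<open>cos x > 0\<close> in auto)
  then show "tan \<bar>Re w\<bar> \<le> cmod (tan w)"
    using nz \<open>cos x > 0\<close> by (simp add: tan_def norm_divide field_simps flip: x_def)
qed

section \<open>The Schwarz lemma with prescribed derivative at the origin\<close>

text \<open>The hypothesis places \<open>k\<close> in the pseudo-hyperbolic disk of radius
  \<open>r\<close> about \<open>a\<close>; the bound is the largest modulus in that disk, attained
  in the direction of \<open>a\<close>.\<close>

lemma norm_le_of_pseudo_hyperbolic_le:
  fixes k a :: complex
  assumes k: "cmod k < 1" and a: "cmod a < 1" and r: "0 \<le> r" "r < 1"
    and le: "cmod (k - a) \<le> r * cmod (1 - cnj a * k)"
  shows "cmod k \<le> (cmod a + r) / (1 + cmod a * r)"
proof (rule ccontr)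
  define K c where "K = cmod k" and "c = cmod a"
  have nn: "0 \<le> c" "c < 1" using a by (auto simp: c_def)
  have rc: "0 \<le> r * c" "r * c < 1"
    using nn r mult_strict_mono[of r 1 c 1] by auto
  assume "\<not> ?thesis"
  then have gt: "K * (1 + r * c) > c + r"
    using rc by (simp add: K_def c_def not_le divide_less_eq mult.commute)
  have "(cmod (k - a))\<^sup>2 \<le> (r * cmod (1 - cnj a * k))\<^sup>2"
    using le by (intro power_mono) auto
  moreover have "(cmod (k - a))\<^sup>2 = K\<^sup>2 - 2 * Re (cnj a * k) + c\<^sup>2"
    unfolding K_def c_def cmod_power2 by (simp add: power2_eq_square algebra_simps)
  moreover have "(cmod (1 - cnj a * k))\<^sup>2 = 1 - 2 * Re (cnj a * k) + c\<^sup>2 * K\<^sup>2"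
    unfolding K_def c_def cmod_power2 by (simp add: power2_eq_square algebra_simps)
  ultimately have "K\<^sup>2 - 2 * Re (cnj a * k) + c\<^sup>2 \<le> r\<^sup>2 * (1 - 2 * Re (cnj a * k) + c\<^sup>2 * K\<^sup>2)"
    by (simp add: power_mult_distrib)
  moreover have "(1 - r\<^sup>2) * Re (cnj a * k) \<le> (1 - r\<^sup>2) * (c * K)"
    using complex_Re_le_cmod[of "cnj a * k"] r
    by (intro mult_left_mono) (auto simp: norm_mult K_def c_def power_le_one)
  \<comment> \<open>Replacing \<open>Re (cnj a * k)\<close> by its upper bound \<open>c * K\<close>
    gives a quadratic inequality in \<open>K\<close>, with roots
    \<open>(c + r) / (1 + r * c)\<close> and \<open>(c - r) / (1 - r * c)\<close>.\<close>
  ultimately have "(K * (1 + r * c) - (c + r)) * (K * (1 - r * c) - (c - r)) \<le> 0"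
    by (simp add: algebra_simps power2_eq_square)
  \<comment> \<open>By \<open>gt\<close>, \<open>K\<close> exceeds the first root, which is at least
    the second, so both factors are positive.\<close>
  moreover have "K * (1 - r * c) - (c - r) > 0"
  proof -
    have "(c - r) * (1 + r * c) \<le> (c + r) * (1 - r * c)"
    proof -
      have "r * c\<^sup>2 \<le> r * 1" using nn r by (intro mult_left_mono) (auto simp: power_le_one)
      then show ?thesis by (simp add: algebra_simps power2_eq_square)
    qed
    also have "\<dots> < (K * (1 + r * c)) * (1 - r * c)"
      using gt rc by (intro mult_strict_right_mono) auto
    finally have "(c - r) * (1 + r * c) < (K * (1 - r * c)) * (1 + r * c)"
      by (simp add: mult_ac)
    then show ?thesis using rc by (simp add: mult_less_cancel_right)
  qed
  ultimately show False using gt by (simp add: mult_le_0_iff)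
qed

text \<open>Write \<open>h z = z * k z\<close> with \<open>k 0 = deriv h 0\<close>. Unless
  \<open>h\<close> is a rotation, \<open>k\<close> maps the disk into itself, and the Schwarz-Pick
  estimate comparing \<open>k z\<close> with \<open>k 0\<close> bounds
  \<open>cmod (k z)\<close>.\<close>

lemma Schwarz_Lemma_deriv:
  assumes holh: "h holomorphic_on ball 0 1" and h0: "h 0 = 0"
    and no: "\<And>z. cmod z < 1 \<Longrightarrow> cmod (h z) < 1" and z: "cmod z < 1"
  shows "cmod (h z) \<le> cmod z * ((cmod (deriv h 0) + cmod z) / (1 + cmod (deriv h 0) * cmod z))"
proof -
  note Schwarz = Schwarz_Lemma[OF holh h0 no]
  obtain k where holk: "k holomorphic_on ball 0 1"
    and hk: "\<And>z. cmod z < 1 \<Longrightarrow> h z = z * k z" and dk: "deriv h 0 = k 0"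
    by (rule Schwarz3[OF holh h0]) auto
  show ?thesis
  \<comment> \<open>If \<open>cmod (k 0) = 1\<close>, the fraction equals 1 and the claim is the
    ordinary Schwarz lemma.\<close>
  proof (cases "cmod (k 0) = 1")
    case True
    moreover have "1 + cmod z \<noteq> 0" using norm_ge_zero[of z] by linarith
    ultimately show ?thesis using Schwarz(1)[OF _ z] by (simp add: dk)
  next
    case False
    have k0: "cmod (k 0) < 1"
      using Schwarz(2)[of 0] False by (simp add: dk)
    have k1: "cmod (k w) < 1" if w: "cmod w < 1" for w
    proof (cases "w = 0")
      case nz: False
      \<comment> \<open>Equality in the Schwarz lemma would make \<open>h\<close> a rotation by
        \<open>\<alpha>\<close>, hence \<open>k 0 = \<alpha>\<close> of modulus 1, against the case
        assumption.\<close>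
      have "cmod (h w) \<noteq> cmod w"
      proof
        assume "cmod (h w) = cmod w"
        then obtain \<alpha> where \<alpha>: "\<And>z. cmod z < 1 \<Longrightarrow> h z = \<alpha> * z" "cmod \<alpha> = 1"
          using Schwarz(3)[of 0] w nz by auto
        have "(h has_field_derivative \<alpha>) (at 0)"
        proof (rule has_field_derivative_transform_within_open)
          show "((*) \<alpha> has_field_derivative \<alpha>) (at 0)"
            by (auto intro!: derivative_eq_intros)
        qed (use \<alpha> in \<open>auto intro: open_ball[of 0 1]\<close>)
        then have "k 0 = \<alpha>" using dk DERIV_imp_deriv by metis
        with \<alpha> False show False by simp
      qed
      then have "cmod (h w) < cmod w" using Schwarz(1)[OF _ w] by simp
      then show ?thesis using hk[OF w] nz by (simp add: norm_mult)
    qed (use k0 in simp)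
    \<comment> \<open>The disk automorphism moves \<open>k 0\<close> to 0, so that the Schwarz lemma
      applies to \<open>m\<close>.\<close>
    define m where "m = Moebius_function 0 (k 0) \<circ> k"
    have "m holomorphic_on ball 0 1"
      unfolding m_def
      by (rule holomorphic_on_compose_gen[OF holk Moebius_function_holomorphic[OF k0]]) (use k1 in auto)
    moreover have "m 0 = 0" by (simp add: m_def Moebius_function_eq_zero)
    moreover have "cmod (m w) < 1" if "cmod w < 1" for w
      using Moebius_function_norm_lt_1[OF k0 k1[OF that]] by (simp add: m_def)
    ultimately have "cmod (m z) \<le> cmod z"
      using Schwarz_Lemma(1) z by blast
    moreover have "1 - cnj (k 0) * k z \<noteq> 0"
    proof
      assume "1 - cnj (k 0) * k z = 0"
      then have "cmod (k 0) * cmod (k z) = 1"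
        by (metis complex_mod_cnj eq_iff_diff_eq_0 norm_mult norm_one)
      moreover have "cmod (k 0) * cmod (k z) < 1 * 1"
        using k0 k1[OF z] by (intro mult_strict_mono) auto
      ultimately show False by simp
    qed
    ultimately have "cmod (k z - k 0) \<le> cmod z * cmod (1 - cnj (k 0) * k z)"
      by (simp add: m_def Moebius_function_simple norm_divide divide_le_eq)
    then have "cmod (k z) \<le> (cmod (k 0) + cmod z) / (1 + cmod (k 0) * cmod z)"
      using norm_le_of_pseudo_hyperbolic_le k1[OF z] k0 z by simp
    then have "cmod z * cmod (k z) \<le> cmod z * ((cmod (k 0) + cmod z) / (1 + cmod (k 0) * cmod z))"
      by (intro mult_left_mono) auto
    then show ?thesis
      unfolding hk[OF z] norm_mult dk .
  qed
qed

section \<open>The bound for harmonic maps\<close>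

text \<open>Cross-multiplied, the monotonicity in \<open>c\<close> reduces to
  \<open>t\<^sup>2 \<le> 1\<close>. It is needed because the holomorphic function built below may
  have a derivative at 0 of modulus smaller than \<open>C\<close>. For \<open>C = 1\<close> the
  quotient is 1, in agreement with the convention in \<open>phi\<close>.\<close>

lemma phi_mono:
  assumes "0 \<le> c" "c \<le> C" "C \<le> 1" "0 \<le> t" "t < 1"
  shows "(c + t) / (1 + c * t) \<le> phi C t"
proof -
  have "(C - c) * t\<^sup>2 \<le> (C - c) * 1"
    using assms by (intro mult_left_mono) (auto simp: power_le_one)
  then have "(c + t) * (1 + C * t) \<le> (C + t) * (1 + c * t)"
    by (simp add: algebra_simps power2_eq_square)
  then have "(c + t) / (1 + c * t) \<le> (C + t) / (1 + C * t)"
    using assms by (simp add: frac_le_eq pos_divide_le_eq pos_le_divide_eq add_pos_nonneg mult.commute)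
  also have "\<dots> = phi C t"
    using assms by (simp add: phi_def)
  finally show ?thesis .
qed

theorem theorem12:
  fixes f :: "complex \<Rightarrow> complex" and d C :: real
  assumes "f \<in> ball 0 1 \<rightarrow> ball 0 1"
    and "harmonic_on (ball 0 1) f"
    and "f 0 = 0"
    and "diff_norm f 0 = d" and "d \<le> 4 / pi"
    and "C = pi / 4 * d"
  shows "\<forall>z\<in>ball 0 1. cmod (f z) \<le> 4 / pi * arctan (cmod z * phi C (cmod z))"
proof
  let ?U = "ball 0 1 :: complex set"
  let ?D = "frechet_derivative f (at 0)"
  fix z :: complex assume "z \<in> ?U"
  then have z: "cmod z < 1" by simp
  have harm: "real_harmonic_on ?U (\<lambda>z. Re (f z))" "real_harmonic_on ?U (\<lambda>z. Im (f z))"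
    using assms(2) by (auto simp: harmonic_on_def)
  obtain F1 where F1: "F1 holomorphic_on ?U" "\<And>z. z \<in> ?U \<Longrightarrow> Re (F1 z) = Re (f z)"
    using real_harmonic_on_has_conjugate[OF open_ball convex_ball harm(1)] by blast
  obtain F2 where F2: "F2 holomorphic_on ?U" "\<And>z. z \<in> ?U \<Longrightarrow> Re (F2 z) = Im (f z)"
    using real_harmonic_on_has_conjugate[OF open_ball convex_ball harm(2)] by blast
  \<comment> \<open>Harmonicity speaks of the two real components only;
    \<open>frechet_derivative f (at 0)\<close> is known to be the differential of \<open>f\<close>
    once they are assembled.\<close>
  have "(\<lambda>z. Re (f z)) differentiable (at 0)" "(\<lambda>z. Im (f z)) differentiable (at 0)"
    using harm by (auto simp: real_harmonic_on_def C2_on_def C1_on_def)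
  then obtain A B where "((\<lambda>z. Re (f z)) has_derivative A) (at 0)"
    "((\<lambda>z. Im (f z)) has_derivative B) (at 0)"
    by (auto simp: differentiable_def)
  then have "((\<lambda>z. of_real (Re (f z)) + \<i> * of_real (Im (f z))) has_derivative
      (\<lambda>h. of_real (A h) + \<i> * of_real (B h))) (at 0)"
    by (intro derivative_intros)
  then have "f differentiable (at 0)"
    unfolding complex_eq[symmetric] by (rule differentiableI)
  then have Df: "(f has_derivative ?D) (at 0)"
    by (simp add: frechet_derivative_works)
  have onorm_D: "cmod (?D h) \<le> d * cmod h" for h
    using onorm[OF has_derivative_bounded_linear[OF Df]] assms(4) by (simp add: diff_norm_def)

  obtain e where e: "cmod e = 1" "e * f z = of_real (cmod (f z))"
  proof (cases "f z = 0")
    case False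
    then show ?thesis
      by (intro that[of "of_real (cmod (f z)) / f z"]) (auto simp: norm_divide)
  qed (use that[of 1] in auto)
  \<comment> \<open>\<open>Re (e * f w)\<close> is this real combination of \<open>Re (f w)\<close>
    and \<open>Im (f w)\<close>. Since \<open>f 0 = 0\<close>, \<open>G 0\<close> is purely
    imaginary, so subtracting it gives \<open>F 0 = 0\<close> and leaves the real part
    alone.\<close>
  define G where "G w = of_real (Re e) * F1 w - of_real (Im e) * F2 w" for w
  define F where "F w = G w - G 0" for w
  have holF: "F holomorphic_on ?U"
    unfolding F_def G_def using F1(1) F2(1) by (intro holomorphic_intros)
  have ReF: "Re (F w) = Re (e * f w)" if "w \<in> ?U" for w
    using that F1(2) F2(2) assms(3) by (simp add: F_def G_def)
  have DF: "(F has_field_derivative deriv F 0) (at 0)"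
    using holF by (simp add: holomorphic_derivI)
  have "((\<lambda>w. Re (F w)) has_derivative (\<lambda>h. Re (deriv F 0 * h))) (at 0)"
    using DF unfolding has_field_derivative_def by (intro derivative_intros)
  moreover have "((\<lambda>w. Re (F w)) has_derivative (\<lambda>h. Re (e * ?D h))) (at 0)"
    by (rule has_derivative_transform_within_open[of "\<lambda>w. Re (e * f w)" _ _ _ ?U])
      (use Df ReF in \<open>auto intro!: derivative_intros\<close>)
  ultimately have eqD: "(\<lambda>h. Re (deriv F 0 * h)) = (\<lambda>h. Re (e * ?D h))"
    by (rule has_derivative_unique)
  have "d \<ge> 0" using onorm_D[of 1] norm_ge_zero[of "?D 1"] by (simp del: norm_ge_zero)
  have F'_le: "cmod (deriv F 0) \<le> d"
  proof (cases "deriv F 0 = 0")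
    case False
    \<comment> \<open>The identity \<open>eqD\<close> is tested on the conjugate of
      \<open>deriv F 0\<close>, for which its left side is the full squared modulus.\<close>
    have "(cmod (deriv F 0))\<^sup>2 = Re (deriv F 0 * cnj (deriv F 0))"
      by (simp add: complex_mult_cnj cmod_power2)
    also have "\<dots> = Re (e * ?D (cnj (deriv F 0)))" using eqD by meson
    also have "\<dots> \<le> cmod (e * ?D (cnj (deriv F 0)))" by (rule complex_Re_le_cmod)
    also have "\<dots> \<le> d * cmod (deriv F 0)"
      using onorm_D[of "cnj (deriv F 0)"] e by (simp add: norm_mult)
    finally show ?thesis using False by (simp add: power2_eq_square)
  qed (use \<open>d \<ge> 0\<close> in simp)

  have strip: "\<bar>Re (of_real (pi / 4) * F w)\<bar> < pi / 4" if "w \<in> ?U" for w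
  proof -
    have "\<bar>Re (F w)\<bar> \<le> cmod (e * f w)" using ReF[OF that] abs_Re_le_cmod by metis
    also have "\<dots> < 1" using assms(1) that e by (auto simp: norm_mult)
    finally show ?thesis by (simp add: abs_mult)
  qed
  define h where "h w = tan (of_real (pi / 4) * F w)" for w
  have "h holomorphic_on ?U"
    unfolding h_def tan_def using holF cos_strip_nonzero[OF strip] by (intro holomorphic_intros)
  moreover have "h 0 = 0" by (simp add: h_def F_def)
  moreover have "cmod (h w) < 1" if "cmod w < 1" for w
    unfolding h_def using norm_tan_strip_less_1[OF strip] that by simp
  ultimately have hz: "cmod (h z) \<le> cmod z *
      ((cmod (deriv h 0) + cmod z) / (1 + cmod (deriv h 0) * cmod z))"
    using Schwarz_Lemma_deriv z by blast
  \<comment> \<open>As \<open>F 0 = 0\<close> and the tangent has derivative 1 at 0, only the factor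
    \<open>pi / 4\<close> appears.\<close>
  have "(h has_field_derivative of_real (pi / 4) * deriv F 0) (at 0)"
    unfolding h_def by (rule derivative_eq_intros DF refl | simp add: F_def)+
  then have h': "deriv h 0 = of_real (pi / 4) * deriv F 0" by (rule DERIV_imp_deriv)
  have "cmod (deriv h 0) = pi / 4 * cmod (deriv F 0)"
    unfolding h' norm_mult by simp
  also have "\<dots> \<le> C"
    unfolding assms(6) using F'_le by (intro mult_left_mono) auto
  finally have h'_le: "cmod (deriv h 0) \<le> C" .
  have "C \<le> 1" using assms(5,6) by (simp add: field_simps)
  have "cmod (h z) \<le> cmod z * phi C (cmod z)"
    using hz mult_left_mono[OF phi_mono[OF norm_ge_zero h'_le \<open>C \<le> 1\<close> norm_ge_zero z] norm_ge_zero[of z]]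
    by linarith
  \<comment> \<open>By the choice of \<open>e\<close>, \<open>Re (F z)\<close> is exactly
    \<open>cmod (f z)\<close>.\<close>
  moreover have "tan (pi / 4 * cmod (f z)) \<le> cmod (h z)"
    using tan_Re_le_norm_tan[OF strip[OF \<open>z \<in> ?U\<close>]] ReF[OF \<open>z \<in> ?U\<close>] e
    by (simp add: h_def abs_mult)
  ultimately have "arctan (tan (pi / 4 * cmod (f z))) \<le> arctan (cmod z * phi C (cmod z))"
    by (simp add: arctan_le_iff)
  moreover have "arctan (tan (pi / 4 * cmod (f z))) = pi / 4 * cmod (f z)"
  proof (rule arctan_tan)
    have "cmod (f z) < 1" using assms(1) \<open>z \<in> ?U\<close> by auto
    then show "pi / 4 * cmod (f z) < pi / 2" using pi_gt_zero by (simp add: field_simps)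
    show "- (pi / 2) < pi / 4 * cmod (f z)"
      by (rule less_le_trans[of _ 0]) auto
  qed
  ultimately show "cmod (f z) \<le> 4 / pi * arctan (cmod z * phi C (cmod z))"
    by (simp add: field_simps)
qed

end
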